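(* Let $X$ be a log-concave integer-valued random variable such that $\Pr[X=\mathbb E[X]]<1$. Then $X$ is central moment bounded with parameter $$L=1+\max\left(\mathbb E\big[|X-\mathbb E[X]|\ \big|\ X\ge\mathbb E[X]\big],\ \mathbb E\big[|X-\mathbb E[X]|\ \big|\ X<\mathbb E[X]\big]\right).$$
   Context: A real random variable $Z$ is central moment bounded with parameter $L>0$ if for every integer $i\ge 1$, $\mathbb E[|Z-\mathbb E[Z]|^i]\le i\cdot L\cdot \mathbb E[|Z-\mathbb E[Z]|^{i-1}]$ (with $|\cdot|^0=1$). An integer-valued random variable $X$, with $p_i=\Pr[X=i]$ for $i\in\mathbb Z$, is log-concave if $p_{i+1}^2\ge p_ip_{i+2}$ for all $i\in\mathbb Z$ and the support $\{i:p_i>0\}$ is a set of consecutive integers (no internal zeros). *)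

theory Defs
  imports "HOL-Probability.Probability"
begin

text \<open>The inequality between moments is one between (possibly infinite) expectations. As the
  Bochner integral of a non-integrable function is 0, finiteness of the mean and of all absolute
  central moments, which the inequalities force, is required explicitly.\<close>

definition central_moment_bounded :: "'a measure \<Rightarrow> ('a \<Rightarrow> real) \<Rightarrow> real \<Rightarrow> bool" where
  "central_moment_bounded M Z L \<longleftrightarrow>
     L > 0 \<and> integrable M Z \<and>
     (\<forall>i::nat. i \<ge> 1 \<longrightarrow>
        integrable M (\<lambda>\<omega>. \<bar>Z \<omega> - integral\<^sup>L M Z\<bar> ^ i) \<and>
        integral\<^sup>L M (\<lambda>\<omega>. \<bar>Z \<omega> - integral\<^sup>L M Z\<bar> ^ i)
          \<le> real i * L * integral\<^sup>L M (\<lambda>\<omega>. \<bar>Z \<omega> - integral\<^sup>L M Z\<bar> ^ (i - 1)))"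

definition log_concave_rv :: "'a measure \<Rightarrow> ('a \<Rightarrow> int) \<Rightarrow> bool" where
  "log_concave_rv M X \<longleftrightarrow>
     (let p = (\<lambda>i::int. measure M {\<omega> \<in> space M. X \<omega> = i}) in
        (\<forall>i. (p (i + 1))\<^sup>2 \<ge> p i * p (i + 2)) \<and>
        (\<forall>i j k. i < j \<and> j < k \<and> p i > 0 \<and> p k > 0 \<longrightarrow> p j > 0))"

text \<open>Conditional expectation given an event of positive probability: the expectation with
  respect to \<^term>\<open>uniform_measure M A\<close>, which is the conditional measure \<open>M(\<sqdot> | A)\<close>.\<close>

definition event_cond_exp :: "'a measure \<Rightarrow> ('a \<Rightarrow> real) \<Rightarrow> ('a \<Rightarrow> bool) \<Rightarrow> real" where
  "event_cond_exp M f P = integral\<^sup>L (uniform_measure M {\<omega> \<in> space M. P \<omega>}) f"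

end

theory Submission
  imports Defs
begin

text \<open>On either side of the mean, \<open>\<bar>X - \<mu>\<bar>\<close> takes the values \<open>x + k\<close> (\<open>k = 0, 1, \<dots>\<close>) with
  log-concave weights \<open>q k\<close>, where \<open>0 \<le> x \<le> 1\<close>. The tails \<open>T k = q k + q (k + 1) + \<dots>\<close> satisfy
  \<open>T (t + j) * T 0 \<le> T t * T j\<close>. Hence they decay geometrically, so all moments are finite, and
  \<open>T t + T (t + 1) + \<dots> \<le> (1 + m) * T t\<close>, where \<open>m\<close> is the conditional mean of \<open>\<bar>X - \<mu>\<bar>\<close>. Summing
  by layers, the \<open>i\<close>-th moment is at most \<open>i\<close> times the \<open>(i - 1)\<close>-st moment with weights \<open>T\<close>
  in place of \<open>q\<close>, and a second summation by layers turns \<open>T\<close> back into \<open>q\<close> at the cost of the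
  factor \<open>1 + m\<close>. Adding both sides gives the claim.\<close>

section \<open>Tails and summation by layers\<close>

lemma ennreal_suminf_commute:
  fixes f :: "nat \<Rightarrow> nat \<Rightarrow> ennreal"
  shows "(\<Sum>i. \<Sum>j. f i j) = (\<Sum>j. \<Sum>i. f i j)"
  using nn_integral_suminf[of "\<lambda>i j. f i j" "count_space UNIV"]
  by (simp add: nn_integral_count_space_nat)

definition tail :: "(nat \<Rightarrow> ennreal) \<Rightarrow> nat \<Rightarrow> ennreal" where
  "tail q k = (\<Sum>n. q (n + k))"

lemma tail_0: "tail q 0 = suminf q"
  by (simp add: tail_def)

lemma tail_split: "tail q j = (\<Sum>i<t. q (i + j)) + tail q (t + j)"
  using suminf_offset[of "\<lambda>n. q (n + j)" t]
  by (simp add: tail_def add_ac del: ennreal_add_left_cancel)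

lemma tail_antimono: "tail q (k + j) \<le> tail q j"
  by (subst tail_split[of q j k]) simp

text \<open>Summation by parts as an interchange of sums: \<open>d\<close> lists the increments of
  the weight in front of \<open>q\<close>. In \<open>ennreal\<close> this needs no convergence, so
  \<open>tail q\<close> can later take the place of \<open>q\<close>.\<close>

lemma layer_cake:
  "(\<Sum>k. (\<Sum>j\<le>k. d j) * q k) = (\<Sum>j. d j * tail q j)"
proof -
  have "(\<Sum>k. (\<Sum>j\<le>k. d j) * q k) = (\<Sum>k. \<Sum>j. (if j \<le> k then d j * q k else 0))"
  proof (rule arg_cong[where f = suminf], rule ext)
    fix k
    show "(\<Sum>j\<le>k. d j) * q k = (\<Sum>j. (if j \<le> k then d j * q k else 0))"
      by (subst suminf_finite[where N = "{..k}"]) (auto simp: sum_distrib_right)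
  qed
  also have "\<dots> = (\<Sum>j. \<Sum>k. (if j \<le> k then d j * q k else 0))"
    by (rule ennreal_suminf_commute)
  also have "\<dots> = (\<Sum>j. d j * tail q j)"
  proof (rule arg_cong[where f = suminf], rule ext)
    fix j
    show "(\<Sum>k. (if j \<le> k then d j * q k else 0)) = d j * tail q j"
      by (subst suminf_offset[where i = j]) (auto simp: tail_def)
  qed
  finally show ?thesis .
qed

text \<open>Total positivity of order 2: log-concavity without internal zeros, in a form that allows
  products of sums to be compared termwise.\<close>

definition tp2 :: "(nat \<Rightarrow> ennreal) \<Rightarrow> bool" where
  "tp2 q \<longleftrightarrow> (\<forall>a b j. a \<le> b \<longrightarrow> q a * q (b + j) \<le> q (a + j) * q b)"

section \<open>Decay of the tails of a \<open>tp2\<close> sequence\<close>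

text \<open>Splitting \<open>t\<close> terms off \<open>tail q 0\<close> and \<open>tail q j\<close>
  leaves the product \<open>tail q t * tail q (t + j)\<close> on both sides. The other products
  compare termwise by \<open>tp2\<close>, applied to \<open>i < t \<le> n + t\<close> with shift
  \<open>j\<close>.\<close>

lemma tail_submult:
  assumes "tp2 q"
  shows "tail q (t + j) * tail q 0 \<le> tail q t * tail q j"
proof -
  have "q i * tail q (t + j) \<le> q (i + j) * tail q t" if "i < t" for i
    using that assms unfolding tail_def ennreal_suminf_cmult[symmetric] tp2_def
    by (intro suminf_le) (auto simp: add.assoc[symmetric])
  hence "(\<Sum>i<t. q i) * tail q (t + j) \<le> (\<Sum>i<t. q (i + j)) * tail q t"
    by (auto simp: sum_distrib_right intro!: sum_mono)
  hence "((\<Sum>i<t. q i) + tail q t) * tail q (t + j)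
      \<le> ((\<Sum>i<t. q (i + j)) + tail q (t + j)) * tail q t"
    by (simp add: distrib_left distrib_right add_mono mult.commute)
  thus ?thesis
    using tail_split[of q 0 t] tail_split[of q j t] by (simp add: mult.commute)
qed

text \<open>With \<open>tail q 0\<close> divided out, the tails from \<open>t\<close> on sum to at
  most \<open>tail q t\<close> times the mean of \<open>k + 1\<close> under the normalized weights.
  The product form avoids division in \<open>ennreal\<close>.\<close>

lemma tail_tail_le:
  assumes "tp2 q"
  shows "tail q 0 * tail (tail q) t \<le> tail (tail q) 0 * tail q t"
proof -
  have "tail q 0 * tail (tail q) t = (\<Sum>n. tail q 0 * tail q (n + t))"
    by (simp add: tail_def[of "tail q"])
  also have "\<dots> \<le> (\<Sum>n. tail q n * tail q t)"
    using tail_submult[OF assms] by (intro suminf_le) (auto simp: mult.commute)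
  also have "\<dots> = tail (tail q) 0 * tail q t"
    by (simp add: tail_def[of "tail q"])
  finally show ?thesis .
qed

text \<open>As soon as \<open>f N < f 0 / 2\<close>, a shift by \<open>N\<close> at least halves
  \<open>f\<close>, so \<open>f\<close> decays geometrically.\<close>

lemma summable_submult:
  fixes f :: "nat \<Rightarrow> real"
  assumes nonneg: "\<And>k. 0 \<le> f k" and f0: "0 < f 0"
    and sub: "\<And>t j. f (t + j) * f 0 \<le> f t * f j" and lim: "f \<longlonglongrightarrow> 0"
  shows "summable f"
proof -
  from order_tendstoD(2)[OF lim, of "f 0 / 2"] f0 obtain N where N: "f N < f 0 / 2"
    by (auto simp: eventually_sequentially)
  have half: "f (k + N) \<le> f k / 2" for k
  proof -
    have "f (k + N) * f 0 \<le> f k * (f 0 / 2)"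
      using sub[of k N] N nonneg[of k] by (smt (verit) mult_left_mono)
    thus ?thesis using f0 by (simp add: field_simps)
  qed
  \<comment> \<open>The terms with index in \<open>{N..<n + N}\<close> add up to at most half of the
    sum being bounded, and this half is absorbed on the left.\<close>
  have "(\<Sum>k<n. f k) \<le> 2 * (\<Sum>k<N. f k)" for n
  proof -
    have "(\<Sum>k<n. f k) \<le> (\<Sum>k<n + N. f k)"
      using nonneg by (intro sum_mono2) auto
    also have "\<dots> = (\<Sum>k<N. f k) + (\<Sum>k<n. f (k + N))"
      by (induction n) (auto simp: add_ac)
    also have "(\<Sum>k<n. f (k + N)) \<le> (\<Sum>k<n. f k / 2)"
      using half by (intro sum_mono) auto
    also have "\<dots> = (\<Sum>k<n. f k) / 2"
      by (simp add: sum_divide_distrib)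
    finally show ?thesis by simp
  qed
  thus ?thesis
    by (intro summableI_nonneg_bounded) (use nonneg in auto)
qed

lemma tail_tail_finite:
  assumes "tp2 q" and fin: "suminf q < top"
  shows "tail (tail q) 0 < top"
proof (cases "tail q 0 = 0")
  case True
  hence "tail q k = 0" for k using tail_antimono[of q k 0] by simp
  thus ?thesis by (simp add: tail_def[of "tail q"])
next
  case False
  \<comment> \<open>Finite total mass allows the passage to reals, where the tails of a convergent
    series tend to 0.\<close>
  define r where "r k = enn2real (q k)" for k
  define f where "f k = (\<Sum>n. r (n + k))" for k
  have r: "q k = ennreal (r k)" "0 \<le> r k" for k
    using ennreal_suminf_lessD[OF fin, of k] by (simp_all add: r_def)
  have sr: "summable r"
    using fin r by (intro summable_suminf_not_top) (auto simp flip: r(1))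
  hence sr': "summable (\<lambda>n. r (n + k))" for k by simp
  have f: "tail q k = ennreal (f k)" "0 \<le> f k" for k
    using r sr' by (auto simp: tail_def f_def suminf_ennreal2 intro!: suminf_nonneg)
  have "summable f"
  proof (rule summable_submult)
    show "f (t + j) * f 0 \<le> f t * f j" for t j
      using tail_submult[OF assms(1), of t j] f by (simp flip: ennreal_mult)
    show "f \<longlonglongrightarrow> 0"
      unfolding f_def by (rule suminf_exist_split2[OF sr])
  qed (use False f in \<open>auto simp: less_le\<close>)
  hence "(\<Sum>k. ennreal (f k)) \<noteq> top"
    using f(2) by (rule ennreal_suminf_neq_top)
  moreover have "tail q = (\<lambda>k. ennreal (f k))"
    using f(1) by (rule ext)
  ultimately show ?thesis
    by (simp only: tail_0 less_top[symmetric] not_False_eq_True)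
qed

section \<open>Moments of sequences shifted by \<open>x\<close>\<close>

text \<open>A mean value bound: on \<open>[x, x + 1]\<close> the derivative of the power is largest
  at the right end.\<close>

lemma power_Suc_diff_le:
  fixes x :: real
  assumes "0 \<le> x" "1 \<le> i"
  shows "(x + 1) ^ i - x ^ i \<le> real i * (x + 1) ^ (i - 1)"
proof -
  have "(x + 1) ^ Suc n - x ^ Suc n \<le> real (Suc n) * (x + 1) ^ n" for n
  proof (induction n)
    case (Suc n)
    have "(x + 1) ^ Suc (Suc n) - x ^ Suc (Suc n) = (x + 1) * ((x + 1) ^ Suc n - x ^ Suc n) + x ^ Suc n"
      by (simp add: algebra_simps)
    also have "\<dots> \<le> (x + 1) * (real (Suc n) * (x + 1) ^ n) + (x + 1) ^ Suc n"
      using assms Suc by (intro add_mono mult_left_mono power_mono) auto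
    finally show ?case by (simp add: algebra_simps)
  qed simp
  from this[of "i - 1"] assms show ?thesis by (simp del: power_Suc)
qed

text \<open>The increments \<open>d\<close> depend on \<open>x\<close> and \<open>n\<close> but not
  on \<open>q\<close>, so the same ones serve for \<open>q\<close> and for
  \<open>tail q\<close>.\<close>

lemma shifted_moment_layers:
  fixes x :: real
  assumes "0 \<le> x"
  obtains d where "\<And>q. (\<Sum>k. ennreal ((x + real k) ^ n) * q k) = (\<Sum>j. d j * tail q j)"
    and "d 0 = ennreal (x ^ n)"
    and "\<And>j. d (Suc j) = ennreal ((x + real (Suc j)) ^ n - (x + real j) ^ n)"
proof -
  define d where "d j = (case j of 0 \<Rightarrow> ennreal (x ^ n)
    | Suc j \<Rightarrow> ennreal ((x + real (Suc j)) ^ n - (x + real j) ^ n))" for j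
  have "(\<Sum>j\<le>k. d j) = ennreal ((x + real k) ^ n)" for k
  proof (induction k)
    case (Suc k)
    have "(x + real k) ^ n \<le> (x + real (Suc k)) ^ n"
      using assms by (intro power_mono) auto
    thus ?case using Suc assms by (simp add: d_def flip: ennreal_plus)
  qed (simp add: d_def)
  hence "(\<Sum>k. ennreal ((x + real k) ^ n) * q k) = (\<Sum>j. d j * tail q j)" for q
    using layer_cake[of d q] by simp
  with that[of d] show thesis by (simp add: d_def)
qed

text \<open>Together the two bounds yield the factor \<open>1 + S 1 / S 0\<close>, one plus the
  conditional mean. Keeping \<open>S 0\<close> as a factor on the left covers weights of total mass
  zero as well.\<close>

lemma shifted_moment_le:
  fixes x :: real
  assumes "tp2 q" and x: "0 \<le> x" "x \<le> 1" and i: "1 \<le> i"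
  defines "S \<equiv> \<lambda>n. (\<Sum>k. ennreal ((x + real k) ^ n) * q k)"
  shows "S 0 * S i \<le> ennreal (real i) * tail (tail q) 0 * S (i - 1)"
    and "tail (tail q) 0 \<le> S 0 + S 1"
proof -
  have S0: "S 0 = tail q 0" by (simp add: S_def tail_0)
  \<comment> \<open>Constant increments 1 have the partial sums \<open>Suc k\<close>.\<close>
  have tt: "tail (tail q) 0 = (\<Sum>k. of_nat (Suc k) * q k)"
    using layer_cake[of "\<lambda>_. 1" q] by (simp add: tail_0)
  show "tail (tail q) 0 \<le> S 0 + S 1"
  proof -
    have "S 0 + S 1 = (\<Sum>k. q k + ennreal (x + real k) * q k)"
      by (simp add: S_def suminf_add)
    also have "\<dots> \<ge> tail (tail q) 0"
      unfolding tt using x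
      by (intro suminf_le) (auto simp: distrib_right ennreal_of_nat_eq_real_of_nat 
          intro!: add_mono mult_right_mono ennreal_leI)
    finally show ?thesis .
  qed
  obtain d where d: "\<And>q. (\<Sum>k. ennreal ((x + real k) ^ i) * q k) = (\<Sum>j. d j * tail q j)"
    "d 0 = ennreal (x ^ i)"
    "\<And>j. d (Suc j) = ennreal ((x + real (Suc j)) ^ i - (x + real j) ^ i)"
    using shifted_moment_layers[OF x(1), of i] by blast
  obtain e where e: "\<And>q. (\<Sum>k. ennreal ((x + real k) ^ (i - 1)) * q k) = (\<Sum>j. e j * tail q j)"
    using shifted_moment_layers[OF x(1), of "i - 1"] by metis
  have d_le: "d j \<le> ennreal (real i * (x + real j) ^ (i - 1))" for j
  proof (cases j)
    \<comment> \<open>The lowest increment is all of \<open>x ^ i\<close>, not a difference;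
      \<open>x \<le> 1 \<le> i\<close> bounds it.\<close>
    case 0
    have "x ^ i = x * x ^ (i - 1)" using i by (simp add: power_eq_if)
    also have "\<dots> \<le> real i * x ^ (i - 1)"
      using x i by (intro mult_right_mono) auto
    finally show ?thesis using 0 d by (auto intro: ennreal_leI)
  next
    case (Suc k)
    have "(x + real k + 1) ^ i - (x + real k) ^ i \<le> real i * (x + real k + 1) ^ (i - 1)"
      using x i by (intro power_Suc_diff_le) auto
    thus ?thesis using Suc d by (auto intro!: ennreal_leI simp: add_ac)
  qed
  have "S i \<le> (\<Sum>j. ennreal (real i) * (ennreal ((x + real j) ^ (i - 1)) * tail q j))"
    unfolding S_def d using d_le x
    by (intro suminf_le) (auto simp: ennreal_mult mult.assoc[symmetric] intro!: mult_right_mono)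
  \<comment> \<open>Second summation by layers, now with weights \<open>tail q\<close>. Then
    \<open>tail_tail_le\<close> acts on each layer, and the layers are summed back to a moment of
    \<open>q\<close>.\<close>
  also have "\<dots> = ennreal (real i) * (\<Sum>j. e j * tail (tail q) j)"
    by (simp only: e ennreal_suminf_cmult)
  finally have "S 0 * S i \<le> S 0 * (ennreal (real i) * (\<Sum>j. e j * tail (tail q) j))"
    by (rule mult_left_mono) simp
  also have "\<dots> = ennreal (real i) * (\<Sum>j. e j * (tail q 0 * tail (tail q) j))"
    by (simp add: S0 mult_ac flip: ennreal_suminf_cmult)
  also have "\<dots> \<le> ennreal (real i) * (\<Sum>j. e j * (tail (tail q) 0 * tail q j))"
    using tail_tail_le[OF assms(1)]
    by (intro mult_left_mono suminf_le) auto
  also have "\<dots> = ennreal (real i) * tail (tail q) 0 * S (i - 1)"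
    unfolding S_def e by (simp add: mult_ac flip: ennreal_suminf_cmult)
  finally show "S 0 * S i \<le> ennreal (real i) * tail (tail q) 0 * S (i - 1)" .
qed

section \<open>From log-concavity to total positivity\<close>

lemma log_concave_tp2:
  fixes q :: "nat \<Rightarrow> real"
  assumes nonneg: "\<And>k. 0 \<le> q k"
    and lc: "\<And>k. q k * q (k + 2) \<le> (q (k + 1))\<^sup>2"
    and conn: "\<And>i j k. i < j \<Longrightarrow> j < k \<Longrightarrow> 0 < q i \<Longrightarrow> 0 < q k \<Longrightarrow> 0 < q j"
  shows "tp2 (\<lambda>k. ennreal (q k))"
proof -
  \<comment> \<open>The ratio of neighbours is nonincreasing, stated without division. When the left
    product at \<open>b + 1\<close> is nonzero, the absence of internal zeros makes
    \<open>q b\<close> positive, so it can be cancelled.\<close>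
  have step: "q a * q (b + 1) \<le> q (a + 1) * q b" if "a \<le> b" for a b
    using that
  proof (induction b rule: dec_induct)
    case (step b)
    show ?case
    proof (cases "q a * q (b + 2) = 0")
      case False
      hence pos: "0 < q a" "0 < q (b + 2)" using nonneg[of a] nonneg[of "b + 2"] by auto
      hence b: "0 < q b" using conn[of a b "b + 2"] step by (cases "a = b") auto
      have "q b * (q a * q (b + 2)) \<le> q a * (q (b + 1))\<^sup>2"
        using mult_left_mono[OF lc[of b], of "q a"] nonneg[of a] by (simp add: mult_ac)
      also have "\<dots> \<le> (q (a + 1) * q b) * q (b + 1)"
        using mult_right_mono[OF step.IH nonneg[of "b + 1"]] by (simp add: power2_eq_square mult_ac)
      finally show ?thesis using b by (simp add: mult_ac)
    qed (use nonneg in \<open>auto simp del: power_Suc\<close>)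
  qed simp
  have "q a * q (b + j) \<le> q (a + j) * q b" if "a \<le> b" for a b j
    using that
  proof (induction j arbitrary: a)
    case (Suc j)
    show ?case
    proof (cases "a = b")
      case False
      \<comment> \<open>One unit moves from the far index to the near one; \<open>a < b\<close>
        keeps \<open>a + 1 \<le> b\<close> for the induction hypothesis.\<close>
      have "q a * q (b + Suc j) \<le> q (a + 1) * q (b + j)"
        using step[of a "b + j"] Suc by simp
      also have "\<dots> \<le> q (a + 1 + j) * q b"
        using Suc False by (intro Suc.IH) auto
      finally show ?thesis by simp
    qed simp
  qed simp
  thus ?thesis using nonneg by (auto simp: tp2_def intro!: ennreal_leI simp flip: ennreal_mult)
qed

section \<open>One side of the mean\<close>

text \<open>By injectivity of \<open>s\<close> at most one summand is nonzero at each point, so the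
  integrand is a series that can be integrated termwise.\<close>

lemma nn_integral_on_range:
  fixes X :: "'a \<Rightarrow> int" and s :: "nat \<Rightarrow> int"
  assumes [measurable]: "X \<in> measurable M (count_space UNIV)" and "inj s"
  shows "(\<integral>\<^sup>+\<omega>. f (X \<omega>) * indicator {\<omega> \<in> space M. X \<omega> \<in> range s} \<omega> \<partial>M)
    = (\<Sum>k. f (s k) * emeasure M {\<omega> \<in> space M. X \<omega> = s k})"
proof -
  have "(\<integral>\<^sup>+\<omega>. f (X \<omega>) * indicator {\<omega> \<in> space M. X \<omega> \<in> range s} \<omega> \<partial>M)
    = (\<integral>\<^sup>+\<omega>. (\<Sum>k. f (s k) * indicator {\<omega> \<in> space M. X \<omega> = s k} \<omega>) \<partial>M)"
  proof (rule nn_integral_cong)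
    fix \<omega> assume \<omega>: "\<omega> \<in> space M"
    show "f (X \<omega>) * indicator {\<omega> \<in> space M. X \<omega> \<in> range s} \<omega>
      = (\<Sum>k. f (s k) * indicator {\<omega> \<in> space M. X \<omega> = s k} \<omega>)"
    proof (cases "X \<omega> \<in> range s")
      case True
      then obtain n where n: "X \<omega> = s n" by auto
      have "(\<Sum>k. f (s k) * indicator {\<omega> \<in> space M. X \<omega> = s k} \<omega>)
        = (\<Sum>k\<in>{n}. f (s k) * indicator {\<omega> \<in> space M. X \<omega> = s k} \<omega>)"
        using assms(2) n by (intro suminf_finite) (auto simp: inj_eq)
      thus ?thesis using n \<omega> by simp
    next
      case False
      hence "X \<omega> \<noteq> s k" for k by auto
      with False show ?thesis by simp
    qed
  qed
  also have "\<dots> = (\<Sum>k. f (s k) * emeasure M {\<omega> \<in> space M. X \<omega> = s k})"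
    by (simp add: nn_integral_suminf nn_integral_cmult_indicator)
  finally show ?thesis .
qed

text \<open>Here \<open>s\<close> lists the integers on one side of \<open>\<mu>\<close> outwards,
  and \<open>x\<close> is the distance to the first of them. As \<open>\<mu>\<close> is any real,
  integrability of \<open>X\<close> can be deduced from this lemma.\<close>

lemma log_concave_side:
  fixes X :: "'a \<Rightarrow> int" and s :: "nat \<Rightarrow> int" and x \<mu> :: real
  assumes "prob_space M" and [measurable]: "X \<in> measurable M (count_space UNIV)"
    and tp2: "tp2 (\<lambda>k. emeasure M {\<omega> \<in> space M. X \<omega> = s k})"
    and x: "0 \<le> x" "x \<le> 1" and s: "\<And>k. \<bar>real_of_int (s k) - \<mu>\<bar> = x + real k"
    and P: "\<And>\<omega>. P \<omega> \<longleftrightarrow> X \<omega> \<in> range s"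
  defines "g \<equiv> \<lambda>n \<omega>. \<bar>real_of_int (X \<omega>) - \<mu>\<bar> ^ n * indicator {\<omega> \<in> space M. P \<omega>} \<omega>"
  shows "integrable M (g n)"
    and "1 \<le> i \<Longrightarrow> integral\<^sup>L M (g i)
      \<le> real i * (1 + event_cond_exp M (\<lambda>\<omega>. \<bar>real_of_int (X \<omega>) - \<mu>\<bar>) P) * integral\<^sup>L M (g (i - 1))"
proof -
  interpret prob_space M by fact
  define q where "q k = emeasure M {\<omega> \<in> space M. X \<omega> = s k}" for k
  define S where "S n = (\<Sum>k. ennreal ((x + real k) ^ n) * q k)" for n
  have "tp2 q" using tp2 unfolding q_def[abs_def] .
  have inj: "inj s"
  proof (rule injI)
    fix a b assume "s a = s b"
    hence "x + real a = x + real b"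
      using s by metis
    thus "a = b" by simp
  qed
  have A[measurable]: "{\<omega> \<in> space M. P \<omega>} \<in> sets M" unfolding P by measurable
  have nn: "(\<integral>\<^sup>+\<omega>. ennreal (\<bar>real_of_int (X \<omega>) - \<mu>\<bar> ^ n) * indicator {\<omega> \<in> space M. P \<omega>} \<omega> \<partial>M) = S n" for n
    using nn_integral_on_range[OF assms(2) inj, of "\<lambda>z. ennreal (\<bar>real_of_int z - \<mu>\<bar> ^ n)"]
    by (simp add: P s S_def q_def)
  have gm[measurable]: "g n \<in> borel_measurable M" for n
    unfolding g_def by measurable
  have g0: "0 \<le> g n \<omega>" for n \<omega> by (simp add: g_def)
  have nng: "(\<integral>\<^sup>+\<omega>. ennreal (g n \<omega>) \<partial>M) = S n" for n
    unfolding nn[symmetric] g_def by (intro nn_integral_cong) (auto split: split_indicator)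
  have S0: "S 0 = emeasure M {\<omega> \<in> space M. P \<omega>}" using nn[of 0] by simp
  hence S0': "S 0 = suminf q" "S 0 < top" by (simp_all add: S_def less_top[symmetric])
  note step = shifted_moment_le[OF \<open>tp2 q\<close> x, folded S_def]
  have tt: "tail (tail q) 0 < top" using tail_tail_finite[OF \<open>tp2 q\<close>] S0' by simp
  \<comment> \<open>Each moment bounds the next one up to a finite factor, provided that the side
    has positive mass.\<close>
  have fin: "S n < top" for n
  proof (induction n)
    case (Suc n)
    show ?case
    proof (cases "S 0 = 0")
      case True
      hence "q k = 0" for k using S0' by (simp add: suminf_eq_zero_iff)
      thus ?thesis by (simp add: S_def)
    next
      case False
      have "S 0 * S (Suc n) \<le> ennreal (real (Suc n)) * tail (tail q) 0 * S n"
        using step(1)[of "Suc n"] by simp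
      also have "\<dots> < top"
        using tt Suc by (simp add: ennreal_mult_less_top)
      finally have "S 0 * S (Suc n) < top" .
      thus ?thesis using False by (auto simp: ennreal_mult_less_top)
    qed
  qed (use S0' in simp)
  show int: "integrable M (g n)" for n
    using g0 nng[of n] fin[of n] by (intro integrableI_nonneg) auto
  have Sg: "S n = ennreal (integral\<^sup>L M (g n))" for n
    using nn_integral_eq_integral[OF int[of n]] g0 nng[of n] by simp
  have pos: "0 \<le> integral\<^sup>L M (g n)" for n using g0 by simp
  show "integral\<^sup>L M (g i)
      \<le> real i * (1 + event_cond_exp M (\<lambda>\<omega>. \<bar>real_of_int (X \<omega>) - \<mu>\<bar>) P) * integral\<^sup>L M (g (i - 1))"
    if i: "1 \<le> i"
  proof (cases "S 0 = 0")
    \<comment> \<open>On a null side all moments vanish, whatever value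
      \<open>event_cond_exp\<close> takes there.\<close>
    case True
    hence "q k = 0" for k using S0' by (simp add: suminf_eq_zero_iff)
    hence "S n = 0" for n by (simp add: S_def)
    hence "integral\<^sup>L M (g n) = 0" for n using Sg[of n] pos[of n] by simp
    thus ?thesis by simp
  next
    case False
    hence a0: "0 < integral\<^sup>L M (g 0)" using Sg[of 0] pos[of 0] by (auto simp: less_le)
    have "event_cond_exp M (\<lambda>\<omega>. \<bar>real_of_int (X \<omega>) - \<mu>\<bar>) P = enn2real (S 1 / S 0)"
      unfolding event_cond_exp_def using nn[of 1]
      by (subst integral_eq_nn_integral) (auto simp: nn_integral_uniform_measure S0)
    also have "\<dots> = integral\<^sup>L M (g 1) / integral\<^sup>L M (g 0)"
      using a0 pos by (simp add: Sg divide_ennreal)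
    finally have ece: "event_cond_exp M (\<lambda>\<omega>. \<bar>real_of_int (X \<omega>) - \<mu>\<bar>) P
      = integral\<^sup>L M (g 1) / integral\<^sup>L M (g 0)" .
    \<comment> \<open>Dividing by \<open>S 0\<close> twice turns \<open>S 0 + S 1\<close> into one
      plus the conditional mean and cancels the factor on the left.\<close>
    have "S 0 * S i \<le> ennreal (real i) * (S 0 + S 1) * S (i - 1)"
      by (rule order_trans[OF step(1)[OF i]]) (intro mult_mono step(2)[OF i] order_refl, auto)
    hence "integral\<^sup>L M (g 0) * integral\<^sup>L M (g i)
        \<le> real i * (integral\<^sup>L M (g 0) + integral\<^sup>L M (g 1)) * integral\<^sup>L M (g (i - 1))"
      unfolding Sg using pos by (simp flip: ennreal_mult ennreal_plus)
    thus ?thesis using a0 unfolding ece by (simp add: field_simps)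
  qed
qed

section \<open>Joining the two sides\<close>

lemma log_concave_rv_tp2:
  fixes X :: "'a \<Rightarrow> int"
  assumes "prob_space M" "log_concave_rv M X"
  shows "tp2 (\<lambda>k. emeasure M {\<omega> \<in> space M. X \<omega> = c + int k})"
    and "tp2 (\<lambda>k. emeasure M {\<omega> \<in> space M. X \<omega> = c - int k})"
proof -
  interpret prob_space M by fact
  define p where "p i = prob {\<omega> \<in> space M. X \<omega> = i}" for i
  have lc: "p i * p (i + 2) \<le> (p (i + 1))\<^sup>2" for i
    using assms(2) by (auto simp: log_concave_rv_def Let_def p_def)
  have conn: "0 < p j" if "i < j" "j < k" "0 < p i" "0 < p k" for i j k
    using assms(2) that unfolding log_concave_rv_def Let_def p_def by blast
  have nonneg: "0 \<le> p i" for i by (simp add: p_def)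
  have "tp2 (\<lambda>k. ennreal (p (c + int k)))"
  proof (rule log_concave_tp2[OF nonneg])
    show "p (c + int k) * p (c + int (k + 2)) \<le> (p (c + int (k + 1)))\<^sup>2" for k
      using lc[of "c + int k"] by (simp add: add_ac)
    show "0 < p (c + int j)" if "i < j" "j < k" "0 < p (c + int i)" "0 < p (c + int k)" for i j k
      by (rule conn[of "c + int i" _ "c + int k"]) (use that in auto)
  qed
  thus "tp2 (\<lambda>k. emeasure M {\<omega> \<in> space M. X \<omega> = c + int k})"
    by (simp add: p_def emeasure_eq_measure)
  have "tp2 (\<lambda>k. ennreal (p (c - int k)))"
  proof (rule log_concave_tp2[OF nonneg])
    show "p (c - int k) * p (c - int (k + 2)) \<le> (p (c - int (k + 1)))\<^sup>2" for k
      \<comment> \<open>Running downwards reverses the triple, so its lowest index is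
        \<open>c - int k - 2\<close>.\<close>
      using lc[of "c - int k - 2"] by (simp add: algebra_simps)
    show "0 < p (c - int j)" if "i < j" "j < k" "0 < p (c - int i)" "0 < p (c - int k)" for i j k
      by (rule conn[of "c - int k" _ "c - int i"]) (use that in auto)
  qed
  thus "tp2 (\<lambda>k. emeasure M {\<omega> \<in> space M. X \<omega> = c - int k})"
    by (simp add: p_def emeasure_eq_measure)
qed

theorem lemma7p5:
  fixes M :: "'a measure" and X :: "'a \<Rightarrow> int" and \<mu> :: real
  assumes "prob_space M"
    and "X \<in> measurable M (count_space UNIV)"
    and "log_concave_rv M X"
    and "\<mu> = integral\<^sup>L M (\<lambda>\<omega>. real_of_int (X \<omega>))"
    and "measure M {\<omega> \<in> space M. real_of_int (X \<omega>) = \<mu>} < 1"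
  shows "central_moment_bounded M (\<lambda>\<omega>. real_of_int (X \<omega>))
    (1 + max (event_cond_exp M (\<lambda>\<omega>. \<bar>real_of_int (X \<omega>) - \<mu>\<bar>) (\<lambda>\<omega>. real_of_int (X \<omega>) \<ge> \<mu>))
             (event_cond_exp M (\<lambda>\<omega>. \<bar>real_of_int (X \<omega>) - \<mu>\<bar>) (\<lambda>\<omega>. real_of_int (X \<omega>) < \<mu>)))"
proof -
  interpret prob_space M by fact
  note [measurable] = assms(2)
  \<comment> \<open>The upper side starts at \<open>c\<close> with offset \<open>c - \<mu>\<close>
    in [0, 1), the lower side at \<open>c - 1\<close> with offset \<open>\<mu> - c + 1\<close> in
    (0, 1]. Offset 1 occurs when \<open>\<mu>\<close> is an integer.\<close>
  define c where "c = \<lceil>\<mu>\<rceil>"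
  have c: "\<mu> \<le> real_of_int c" "real_of_int c < \<mu> + 1"
    unfolding c_def by linarith+
  let ?U = "\<lambda>\<omega>. real_of_int (X \<omega>) \<ge> \<mu>" and ?D = "\<lambda>\<omega>. real_of_int (X \<omega>) < \<mu>"
  let ?Y = "\<lambda>\<omega>. \<bar>real_of_int (X \<omega>) - \<mu>\<bar>"
  define gU where "gU n \<omega> = ?Y \<omega> ^ n * indicator {\<omega> \<in> space M. ?U \<omega>} \<omega>" for n \<omega>
  define gD where "gD n \<omega> = ?Y \<omega> ^ n * indicator {\<omega> \<in> space M. ?D \<omega>} \<omega>" for n \<omega>
  have rangeU: "?U \<omega> \<longleftrightarrow> X \<omega> \<in> range (\<lambda>k. c + int k)" for \<omega>
  proof
    assume "?U \<omega>"
    hence "c \<le> X \<omega>" unfolding c_def by (simp add: ceiling_le_iff)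
    thus "X \<omega> \<in> range (\<lambda>k. c + int k)" by (intro image_eqI[of _ _ "nat (X \<omega> - c)"]) auto
  qed (use c in auto)
  have rangeD: "?D \<omega> \<longleftrightarrow> X \<omega> \<in> range (\<lambda>k. (c - 1) - int k)" for \<omega>
  proof
    assume "?D \<omega>"
    hence "X \<omega> < c" using c by linarith
    thus "X \<omega> \<in> range (\<lambda>k. (c - 1) - int k)" by (intro image_eqI[of _ _ "nat (c - 1 - X \<omega>)"]) auto
  qed (use c in auto)
  note U = log_concave_side[OF assms(1,2) log_concave_rv_tp2(1)[OF assms(1,3), of c],
      of "c - \<mu>" \<mu> ?U, folded gU_def]
  note D = log_concave_side[OF assms(1,2) log_concave_rv_tp2(2)[OF assms(1,3), of "c - 1"],
      of "\<mu> - c + 1" \<mu> ?D, folded gD_def]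
  have intU: "integrable M (gU n)" for n
    by (rule U(1)) (use c rangeU in auto)
  have intD: "integrable M (gD n)" for n
    by (rule D(1)) (use c rangeD in auto)
  define eU eD where "eU = event_cond_exp M ?Y ?U" and "eD = event_cond_exp M ?Y ?D"
  have eU_nonneg: "0 \<le> eU" unfolding eU_def event_cond_exp_def by simp
  have leU: "integral\<^sup>L M (gU i) \<le> real i * (1 + eU) * integral\<^sup>L M (gU (i - 1))" if "1 \<le> i" for i
    unfolding eU_def by (rule U(2)) (use c rangeU that in auto)
  have leD: "integral\<^sup>L M (gD i) \<le> real i * (1 + eD) * integral\<^sup>L M (gD (i - 1))" if "1 \<le> i" for i
    unfolding eD_def by (rule D(2)) (use c rangeD that in auto)
  have split: "?Y \<omega> ^ n = gU n \<omega> + gD n \<omega>" if "\<omega> \<in> space M" for n \<omega>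
    using that by (auto simp: gU_def gD_def split: split_indicator)
  have intY: "integrable M (\<lambda>\<omega>. ?Y \<omega> ^ n)" for n
    using Bochner_Integration.integrable_add[OF intU intD, of n n] split
    by (simp cong: Bochner_Integration.integrable_cong)
  have EY: "integral\<^sup>L M (\<lambda>\<omega>. ?Y \<omega> ^ n) = integral\<^sup>L M (gU n) + integral\<^sup>L M (gD n)" for n
    using Bochner_Integration.integral_add[OF intU intD, of n n] split
    by (simp cong: Bochner_Integration.integral_cong)
  \<comment> \<open>Finiteness of the first absolute moment about the number \<open>\<mu>\<close>
    shows that the mean exists, so \<open>\<mu>\<close> is not just the default value 0 of the
    integral.\<close>
  have intX: "integrable M (\<lambda>\<omega>. real_of_int (X \<omega>))"
  proof -
    have "integrable M (\<lambda>\<omega>. real_of_int (X \<omega>) - \<mu>)"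
      using intY[of 1] by (simp add: integrable_abs_iff)
    from Bochner_Integration.integrable_add[OF this, of "\<lambda>_. \<mu>"] show ?thesis by simp
  qed
  have le: "integral\<^sup>L M (\<lambda>\<omega>. ?Y \<omega> ^ i)
      \<le> real i * (1 + max eU eD) * integral\<^sup>L M (\<lambda>\<omega>. ?Y \<omega> ^ (i - 1))" if "1 \<le> i" for i
  proof -
    have "0 \<le> integral\<^sup>L M (gU (i - 1))" "0 \<le> integral\<^sup>L M (gD (i - 1))"
      by (auto simp: gU_def gD_def)
    hence "real i * (1 + eU) * integral\<^sup>L M (gU (i - 1)) \<le> real i * (1 + max eU eD) * integral\<^sup>L M (gU (i - 1))"
      "real i * (1 + eD) * integral\<^sup>L M (gD (i - 1)) \<le> real i * (1 + max eU eD) * integral\<^sup>L M (gD (i - 1))"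
      by (auto intro!: mult_right_mono mult_left_mono)
    with leU[OF that] leD[OF that] show ?thesis
      unfolding EY by (simp only: distrib_left)
  qed
  show ?thesis
    unfolding central_moment_bounded_def assms(4)[symmetric] eU_def[symmetric] eD_def[symmetric]
    using intX intY le eU_nonneg by auto
qed

end
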